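(* Let $M,N,K\in\mathbb{N}$. Then the following hold: (i) There exists $g\in\ell^2(\mathbb{Z})$ with $|\mathrm{supp}\,g|=K$ such that the Gabor system $\{E_{m/M}T_{nN}g\}_{n\in\mathbb{Z},\,m=0,\dots,M-1}$ is a frame for $\ell^2(\mathbb{Z})$ if and only if $N\le M$ and $K\ge N$. (ii) There exists $g\in\ell^2(\mathbb{Z})$ with $|\mathrm{supp}\,g|=K$ such that the Gabor system $\{E_{m/M}T_{nN}g\}_{n\in\mathbb{Z},\,m=0,\dots,M-1}$ is a Riesz sequence in $\ell^2(\mathbb{Z})$ if and only if $N\ge M$ and $K\ge M$.
   Context: $\mathbb{N}=\{1,2,3,\dots\}$. $\ell^2(\mathbb{Z})$ is the complex Hilbert space of square-summable sequences indexed by $\mathbb{Z}$; $g(j)$ denotes the $j$th coordinate of $g\in\ell^2(\mathbb{Z})$. For $M,N\in\mathbb{N}$, $m\in\{0,\dots,M-1\}$ and $n\in\mathbb{Z}$, the modulation operator is $E_{m/M}g(j)=e^{2\pi i jm/M}g(j)$ and the translation operator is $T_n g(j)=g(j-n)$, so $E_{m/M}T_{nN}g(j)=e^{2\pi i jm/M}g(j-nN)$. The Gabor system generated by $g\in\ell^2(\mathbb{Z})$ and $M,N$ is the indexed family $\{E_{m/M}T_{nN}g\}_{n\in\mathbb{Z},\,m=0,\dots,M-1}$. For a finitely supported sequence $g$, $|\mathrm{supp}\,g|$ denotes the number of nonzero entries of $g$. A countable family $\{f_k\}$ in a Hilbert space $H$ is a frame for $H$ if there are constants $A,B>0$ with $A\|f\|^2\le\sum_k|\langle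 f,f_k\rangle|^2\le B\|f\|^2$ for all $f\in H$. It is a Riesz sequence if there are constants $A,B>0$ with $A\sum_k|c_k|^2\le\|\sum_k c_kf_k\|^2\le B\sum_k|c_k|^2$ for all finite scalar sequences $\{c_k\}$. *)

theory Defs
  imports "HOL-Analysis.Analysis"
begin

definition ell2 :: "(int \<Rightarrow> complex) set" where
  "ell2 = {f. (\<lambda>j. (cmod (f j))\<^sup>2) summable_on UNIV}"

definition ell2_inner :: "(int \<Rightarrow> complex) \<Rightarrow> (int \<Rightarrow> complex) \<Rightarrow> complex" where
  "ell2_inner f g = (\<Sum>\<^sub>\<infinity>j\<in>UNIV. f j * cnj (g j))"

definition ell2_norm :: "(int \<Rightarrow> complex) \<Rightarrow> real" where
  "ell2_norm f = sqrt (\<Sum>\<^sub>\<infinity>j\<in>UNIV. (cmod (f j))\<^sup>2)"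

definition supp :: "(int \<Rightarrow> complex) \<Rightarrow> int set" where
  "supp g = {j. g j \<noteq> 0}"

definition modulation :: "nat \<Rightarrow> nat \<Rightarrow> (int \<Rightarrow> complex) \<Rightarrow> int \<Rightarrow> complex" where
  "modulation M m g = (\<lambda>j. exp (2 * of_real pi * \<i> * of_int j * of_nat m / of_nat M) * g j)"

definition translation :: "int \<Rightarrow> (int \<Rightarrow> complex) \<Rightarrow> int \<Rightarrow> complex" where
  "translation n g = (\<lambda>j. g (j - n))"

definition gabor_index :: "nat \<Rightarrow> (int \<times> nat) set" where
  "gabor_index M = UNIV \<times> {..<M}"

definition gabor :: "nat \<Rightarrow> nat \<Rightarrow> (int \<Rightarrow> complex) \<Rightarrow> int \<times> nat \<Rightarrow> int \<Rightarrow> complex" where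
  "gabor M N g = (\<lambda>(n, m). modulation M m (translation (n * int N) g))"

text \<open>Since the infinite sum of a non-summable real family is \<open>0\<close> by convention,
  finiteness of the frame sum (implied by the upper bound) is required explicitly.\<close>

definition is_frame :: "'i set \<Rightarrow> ('i \<Rightarrow> int \<Rightarrow> complex) \<Rightarrow> bool" where
  "is_frame I \<phi> \<longleftrightarrow> countable I \<and> (\<forall>k\<in>I. \<phi> k \<in> ell2) \<and>
     (\<exists>A B. A > 0 \<and> B > 0 \<and>
       (\<forall>f\<in>ell2. (\<lambda>k. (cmod (ell2_inner f (\<phi> k)))\<^sup>2) summable_on I \<and>
          A * (ell2_norm f)\<^sup>2 \<le> (\<Sum>\<^sub>\<infinity>k\<in>I. (cmod (ell2_inner f (\<phi> k)))\<^sup>2) \<and>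
          (\<Sum>\<^sub>\<infinity>k\<in>I. (cmod (ell2_inner f (\<phi> k)))\<^sup>2) \<le> B * (ell2_norm f)\<^sup>2))"

text \<open>A finite scalar sequence is a family of coefficients indexed by a finite subset of \<open>I\<close>.\<close>

definition is_riesz_sequence :: "'i set \<Rightarrow> ('i \<Rightarrow> int \<Rightarrow> complex) \<Rightarrow> bool" where
  "is_riesz_sequence I \<phi> \<longleftrightarrow> countable I \<and> (\<forall>k\<in>I. \<phi> k \<in> ell2) \<and>
     (\<exists>A B. A > 0 \<and> B > 0 \<and>
       (\<forall>F c. finite F \<and> F \<subseteq> I \<longrightarrow>
          A * (\<Sum>k\<in>F. (cmod (c k))\<^sup>2) \<le> (ell2_norm (\<lambda>j. \<Sum>k\<in>F. c k * \<phi> k j))\<^sup>2 \<and>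
          (ell2_norm (\<lambda>j. \<Sum>k\<in>F. c k * \<phi> k j))\<^sup>2 \<le> B * (\<Sum>k\<in>F. (cmod (c k))\<^sup>2)))"

end

theory Submission
  imports Defs
begin

text \<open>
  For sufficiency take \<open>g = 1\<close> on \<open>[0, P)\<close> and \<open>g = 1 / (2 K)\<close> on \<open>[P, K)\<close>, with \<open>P = N\<close> for frames
  and \<open>P = M\<close> for Riesz sequences. The first piece alone generates a tight frame, respectively an
  orthogonal system, with constant \<open>M\<close>, and the second piece is so small in the Bessel sense that
  \<open>|a + b|\<^sup>2 \<ge> |a|\<^sup>2 / 2 - |b|\<^sup>2\<close> preserves a positive lower bound.

  For necessity, if the support misses a residue class \<open>r\<close> modulo \<open>N\<close>, then the unit vector at
  \<open>r\<close> is orthogonal to the whole system; if it misses \<open>r\<close> modulo \<open>M\<close>, then the modulates of \<open>g\<close>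
  satisfy the linear relation with coefficients \<open>exp (- 2 \<pi> \<i> r m / M)\<close>. The density conditions follow
  by counting dimensions on a long interval, where boundary effects are of lower order.
\<close>

section \<open>Linear algebra and inequalities for squared norms\<close>

text \<open>Gaussian elimination, by induction on the number of equations. It supplies the dimension
  counts behind both density conditions.\<close>

lemma homogeneous_system_nontrivial:
  fixes F :: "'a \<Rightarrow> 'b \<Rightarrow> 'c :: field"
  assumes "finite A" "finite X" "card A < card X"
  shows "\<exists>c. (\<exists>x\<in>X. c x \<noteq> 0) \<and> (\<forall>a\<in>A. (\<Sum>x\<in>X. F a x * c x) = 0)"
  using assms
proof (induction A arbitrary: X F rule: finite_induct)
  case empty
  then obtain x where "x \<in> X" by fastforce
  then show ?case by (intro exI[of _ "\<lambda>_. 1"]) auto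
next
  case (insert a A)
  show ?case
  proof (cases "\<forall>x\<in>X. F a x = 0")
    case True
    have "card A < card X" using insert by auto
    from insert.IH[OF insert.prems(1) this] obtain c where
      "\<exists>x\<in>X. c x \<noteq> 0" "\<forall>b\<in>A. (\<Sum>x\<in>X. F b x * c x) = 0" by blast
    then show ?thesis using True by (intro exI[of _ c]) auto
  next
    case False
    then obtain y where y: "y \<in> X" "F a y \<noteq> 0" by auto
    define Y where "Y = X - {y}"
    have Y: "finite Y" "card A < card Y" "y \<notin> Y" and XY: "X = insert y Y"
      using insert y by (auto simp: Y_def)
    \<comment> \<open>Row \<open>a\<close> with pivot \<open>F a y\<close> eliminates the unknown
      \<open>y\<close> from all other equations.\<close>
    from insert.IH[OF Y(1,2), of "\<lambda>b x. F b x - F b y * F a x / F a y"] obtain c where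
      c: "\<exists>x\<in>Y. c x \<noteq> 0" "\<forall>b\<in>A. (\<Sum>x\<in>Y. (F b x - F b y * F a x / F a y) * c x) = 0"
      by blast
    \<comment> \<open>The value at \<open>y\<close> solves equation \<open>a\<close>; by the
      elimination the remaining equations then hold as well.\<close>
    define d where "d = c(y := - (\<Sum>x\<in>Y. F a x * c x) / F a y)"
    have split: "(\<Sum>x\<in>X. F b x * d x) = F b y * d y + (\<Sum>x\<in>Y. F b x * c x)" for b
    proof -
      have "(\<Sum>x\<in>Y. F b x * d x) = (\<Sum>x\<in>Y. F b x * c x)"
        using Y(3) by (intro sum.cong) (auto simp: d_def)
      then show ?thesis using Y by (simp add: XY)
    qed
    have "(\<Sum>x\<in>X. F b x * d x) = 0" if "b \<in> A" for b
    proof -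
      have "(\<Sum>x\<in>Y. (F b x - F b y * F a x / F a y) * c x)
          = (\<Sum>x\<in>Y. F b x * c x) - F b y / F a y * (\<Sum>x\<in>Y. F a x * c x)"
        unfolding sum_distrib_left sum_subtractf[symmetric] by (simp add: left_diff_distrib mult.assoc)
      then show ?thesis using c(2) that unfolding split by (simp add: d_def)
    qed
    moreover have "(\<Sum>x\<in>X. F a x * d x) = 0"
      unfolding split using y by (simp add: d_def)
    moreover have "\<exists>x\<in>X. d x \<noteq> 0" using c(1) Y(3) by (auto simp: d_def XY)
    ultimately show ?thesis by (intro exI[of _ d]) auto
  qed
qed

text \<open>The square expands into a double sum against a Gram matrix, which is \<open>C\<close>
  times the identity. It is used in two dual ways: \<open>X\<close> runs over modulations in the
  frame case and over coordinates in the Riesz case.\<close>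

lemma sum_norm_square_orthogonal:
  fixes e :: "'a \<Rightarrow> 'b \<Rightarrow> complex"
  assumes "finite A"
    and "\<And>a b. a \<in> A \<Longrightarrow> b \<in> A \<Longrightarrow> (\<Sum>x\<in>X. e a x * cnj (e b x)) = (if a = b then of_real C else 0)"
  shows "(\<Sum>x\<in>X. (cmod (\<Sum>a\<in>A. c a * e a x))\<^sup>2) = C * (\<Sum>a\<in>A. (cmod (c a))\<^sup>2)"
proof -
  have "complex_of_real (\<Sum>x\<in>X. (cmod (\<Sum>a\<in>A. c a * e a x))\<^sup>2)
      = (\<Sum>x\<in>X. \<Sum>a\<in>A. \<Sum>b\<in>A. c a * cnj (c b) * (e a x * cnj (e b x)))"
    unfolding of_real_sum
    by (intro sum.cong refl)
      (simp add: complex_norm_square[symmetric] complex_norm_square sum_product mult_ac del: of_real_power)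
  also have "\<dots> = (\<Sum>a\<in>A. \<Sum>x\<in>X. \<Sum>b\<in>A. c a * cnj (c b) * (e a x * cnj (e b x)))"
    by (rule sum.swap)
  also have "\<dots> = (\<Sum>a\<in>A. \<Sum>b\<in>A. \<Sum>x\<in>X. c a * cnj (c b) * (e a x * cnj (e b x)))"
    by (intro sum.cong refl, rule sum.swap)
  also have "\<dots> = (\<Sum>a\<in>A. \<Sum>b\<in>A. if a = b then c a * cnj (c b) * of_real C else 0)"
    unfolding sum_distrib_left[symmetric] by (intro sum.cong refl) (simp add: assms(2))
  also have "\<dots> = (\<Sum>a\<in>A. c a * cnj (c a) * of_real C)"
    using assms(1) by simp
  also have "\<dots> = complex_of_real (C * (\<Sum>a\<in>A. (cmod (c a))\<^sup>2))"
    by (simp add: complex_norm_square[symmetric] sum_distrib_left mult.commute)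
  finally show ?thesis by (simp only: of_real_eq_iff)
qed

text \<open>Write x = (x + y) - y and use (s + t)^2 <= 2 s^2 + 2 t^2.\<close>

lemma norm_add_square_ge:
  fixes x y :: "'a :: real_normed_vector"
  shows "(norm (x + y))\<^sup>2 \<ge> (norm x)\<^sup>2 / 2 - (norm y)\<^sup>2"
proof -
  have "(norm x)\<^sup>2 \<le> (norm (x + y) + norm y)\<^sup>2"
    using norm_triangle_ineq4[of "x + y" y] by (intro power_mono) auto
  also have "\<dots> \<le> 2 * (norm (x + y))\<^sup>2 + 2 * (norm y)\<^sup>2"
    using sum_squares_bound[of "norm (x+y)" "norm y"] by (simp add: power2_sum)
  finally show ?thesis by simp
qed

section \<open>Characters of the integers modulo \<open>M\<close>\<close>

text \<open>Frequency times position enters as a single integer argument, so that shifts and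
  conjugates are absorbed by additivity.\<close>

definition unit_char :: "nat \<Rightarrow> int \<Rightarrow> complex" where
  "unit_char M k = cis (2 * pi * real_of_int k / real M)"

lemma unit_char_add: "unit_char M (j + k) = unit_char M j * unit_char M k"
  by (simp add: unit_char_def cis_mult add_divide_distrib distrib_left)

lemma cnj_unit_char: "cnj (unit_char M k) = unit_char M (- k)"
  by (simp add: unit_char_def cis_cnj)

lemma norm_unit_char [simp]: "cmod (unit_char M k) = 1"
  by (simp add: unit_char_def)

lemma unit_char_mult_of_nat: "unit_char M (k * int n) = unit_char M k ^ n"
  by (simp add: unit_char_def Complex.DeMoivre mult_ac)

lemma unit_char_eq_1_iff:
  assumes "M \<ge> 1"
  shows "unit_char M k = 1 \<longleftrightarrow> int M dvd k"
proof -
  have "unit_char M k = exp (of_real (2 * pi * real_of_int k / real M) * \<i>)"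
    by (simp add: unit_char_def cis_conv_exp mult.commute)
  also have "\<dots> = 1 \<longleftrightarrow> (\<exists>n::int. 2 * pi * real_of_int k / real M = real_of_int (2 * n) * pi)"
    by (simp add: exp_eq_1)
  also have "\<dots> \<longleftrightarrow> (\<exists>n::int. real_of_int k = real_of_int (n * int M))"
    using assms by (auto simp: field_simps)
  also have "\<dots> \<longleftrightarrow> int M dvd k"
    by (simp only: of_int_eq_iff) (auto simp: dvd_def mult.commute)
  finally show ?thesis .
qed

text \<open>If \<open>M\<close> does not divide \<open>k\<close>, this is a geometric sum whose
  ratio is an \<open>M\<close>-th root of unity other than 1. Every orthogonality relation below
  comes from it.\<close>

lemma sum_unit_char_nat:
  assumes "M \<ge> 1"
  shows "(\<Sum>m<M. unit_char M (k * int m)) = (if int M dvd k then of_nat M else 0)"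
proof (cases "int M dvd k")
  case True
  then have "unit_char M k = 1" using assms unit_char_eq_1_iff by blast
  then show ?thesis using True by (simp add: unit_char_mult_of_nat)
next
  case False
  then have "unit_char M k \<noteq> 1" using assms unit_char_eq_1_iff by blast
  moreover have "unit_char M k ^ M = 1"
    using assms unit_char_eq_1_iff[of M "k * int M"] by (simp add: unit_char_mult_of_nat)
  ultimately show ?thesis using False
    by (simp add: unit_char_mult_of_nat sum_gp_strict)
qed

lemma dvd_diff_imp_eq:
  fixes a b :: int
  assumes "int M dvd a - b" "\<bar>a - b\<bar> < int M"
  shows "a = b"
  using assms zdvd_imp_le[of "int M" "\<bar>a - b\<bar>"] by (cases "a = b") auto

section \<open>Gabor systems with finitely supported generators\<close>

lemma gabor_apply:
  "gabor M N g (n, m) j = unit_char M (j * int m) * g (j - n * int N)"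
  by (simp add: gabor_def modulation_def translation_def unit_char_def cis_conv_exp mult_ac)

lemma supp_iff: "j \<in> supp g \<longleftrightarrow> g j \<noteq> 0"
  by (simp add: supp_def)

lemma ell2_finite_support:
  assumes "finite J" "supp f \<subseteq> J"
  shows "f \<in> ell2" and "(ell2_norm f)\<^sup>2 = (\<Sum>j\<in>J. (cmod (f j))\<^sup>2)"
proof -
  have z: "(cmod (f j))\<^sup>2 = 0" if "j \<in> UNIV - J" for j
    using that assms(2) by (auto simp: supp_def)
  have "((\<lambda>j. (cmod (f j))\<^sup>2) has_sum (\<Sum>j\<in>J. (cmod (f j))\<^sup>2)) UNIV"
    using has_sum_finite[OF assms(1), of "\<lambda>j. (cmod (f j))\<^sup>2"] z
    has_sum_cong_neutral[of UNIV J "\<lambda>j. (cmod (f j))\<^sup>2" "\<lambda>j. (cmod (f j))\<^sup>2"] by auto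
  then show "f \<in> ell2" and "(ell2_norm f)\<^sup>2 = (\<Sum>j\<in>J. (cmod (f j))\<^sup>2)"
    by (auto simp: ell2_def ell2_norm_def summable_on_def infsumI sum_nonneg)
qed

lemma sum_le_ell2_norm:
  assumes "f \<in> ell2" "finite J"
  shows "(\<Sum>j\<in>J. (cmod (f j))\<^sup>2) \<le> (ell2_norm f)\<^sup>2"
  using assms finite_sum_le_infsum[of "\<lambda>j. (cmod (f j))\<^sup>2" UNIV J]
  by (simp add: ell2_def ell2_norm_def infsum_nonneg)

lemma ell2_norm_le:
  assumes "f \<in> ell2" "\<And>J. finite J \<Longrightarrow> (\<Sum>j\<in>J. (cmod (f j))\<^sup>2) \<le> B"
  shows "(ell2_norm f)\<^sup>2 \<le> B"
  using assms infsum_le_finite_sums[of "\<lambda>j. (cmod (f j))\<^sup>2" UNIV B]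
  by (simp add: ell2_def ell2_norm_def infsum_nonneg)

lemma ell2_inner_finite_support:
  assumes "finite J" "supp g \<subseteq> J"
  shows "ell2_inner f g = (\<Sum>j\<in>J. f j * cnj (g j))"
proof -
  have "ell2_inner f g = (\<Sum>\<^sub>\<infinity>j\<in>J. f j * cnj (g j))"
    unfolding ell2_inner_def using assms(2) by (intro infsum_cong_neutral) (auto simp: supp_def)
  then show ?thesis using assms(1) by simp
qed

lemma supp_gabor:
  assumes "supp g \<subseteq> T"
  shows "supp (gabor M N g (n, m)) \<subseteq> (\<lambda>i. i + n * int N) ` T"
proof
  fix j assume "j \<in> supp (gabor M N g (n, m))"
  then have "j - n * int N \<in> T" using assms by (auto simp: supp_def gabor_apply)
  then show "j \<in> (\<lambda>i. i + n * int N) ` T" by (intro image_eqI) auto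
qed

lemma gabor_in_ell2:
  assumes "finite (supp g)"
  shows "gabor M N g k \<in> ell2"
  using ell2_finite_support(1)[OF _ supp_gabor[OF order_refl]] assms by (cases k) auto

text \<open>Substituting j = i + n N fixes the window and moves \<open>f\<close> instead. Any finite
  \<open>T\<close> containing the support is allowed, so that different windows can be compared over
  one index set.\<close>

lemma ell2_inner_gabor:
  assumes "finite T" "supp g \<subseteq> T"
  shows "ell2_inner f (gabor M N g (n, m)) =
    (\<Sum>i\<in>T. f (i + n * int N) * cnj (unit_char M ((i + n * int N) * int m) * g i))"
proof -
  have "ell2_inner f (gabor M N g (n, m)) =
      (\<Sum>j\<in>(\<lambda>i. i + n * int N) ` T. f j * cnj (gabor M N g (n, m) j))"
    using assms by (intro ell2_inner_finite_support supp_gabor) auto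
  also have "\<dots> = (\<Sum>i\<in>T. f (i + n * int N) * cnj (gabor M N g (n, m) (i + n * int N)))"
    by (subst sum.reindex) (auto simp: inj_on_def)
  finally show ?thesis by (simp add: gabor_apply)
qed

section \<open>Bessel bounds and the reduction to lower bounds\<close>

text \<open>By Cauchy-Schwarz each coefficient is controlled by the energy of \<open>f\<close> on a
  translate of \<open>T\<close>. For fixed \<open>i\<close> the points i + n N are distinct, so
  summing over \<open>n\<close> costs at most the full energy of \<open>f\<close>; the
  \<open>M\<close> modulations and the points of \<open>T\<close> give the remaining
  factors.\<close>

lemma gabor_bessel_finite:
  assumes "N \<ge> 1" "finite T" "supp g \<subseteq> T" "f \<in> ell2" "finite F" "F \<subseteq> gabor_index M"
  shows "(\<Sum>k\<in>F. (cmod (ell2_inner f (gabor M N g k)))\<^sup>2)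
    \<le> real M * real (card T) * (\<Sum>i\<in>T. (cmod (g i))\<^sup>2) * (ell2_norm f)\<^sup>2"
proof -
  define G where "G = (\<Sum>i\<in>T. (cmod (g i))\<^sup>2)"
  \<comment> \<open>Enlarging \<open>F\<close> to a full product lets the sums over shifts and
    modulations separate.\<close>
  define A where "A = fst ` F"
  have A: "finite A" "F \<subseteq> A \<times> {..<M}"
    using assms(5,6) by (force simp: A_def gabor_index_def)+
  have G0: "G \<ge> 0" by (simp add: G_def sum_nonneg)
  have coeff: "(cmod (ell2_inner f (gabor M N g (n, m))))\<^sup>2
      \<le> (\<Sum>i\<in>T. (cmod (f (i + n * int N)))\<^sup>2) * G" for n m
  proof -
    have "cmod (ell2_inner f (gabor M N g (n, m))) \<le> (\<Sum>i\<in>T. cmod (f (i + n * int N)) * cmod (g i))"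
      unfolding ell2_inner_gabor[OF assms(2,3)]
      by (rule order_trans[OF norm_sum]) (simp add: norm_mult)
    then have "(cmod (ell2_inner f (gabor M N g (n, m))))\<^sup>2
        \<le> (\<Sum>i\<in>T. cmod (f (i + n * int N)) * cmod (g i))\<^sup>2"
      by (intro power_mono) auto
    also have "\<dots> \<le> (\<Sum>i\<in>T. (cmod (f (i + n * int N)))\<^sup>2) * G"
      unfolding G_def by (rule Cauchy_Schwarz_ineq_sum)
    finally show ?thesis .
  qed
  have shift: "(\<Sum>n\<in>A. (cmod (f (i + n * int N)))\<^sup>2) \<le> (ell2_norm f)\<^sup>2" for i
  proof -
    have "(\<Sum>n\<in>A. (cmod (f (i + n * int N)))\<^sup>2) = (\<Sum>j\<in>(\<lambda>n. i + n * int N) ` A. (cmod (f j))\<^sup>2)"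
      using assms(1) by (subst sum.reindex) (auto simp: inj_on_def)
    also have "\<dots> \<le> (ell2_norm f)\<^sup>2"
      using A assms(4) by (intro sum_le_ell2_norm) auto
    finally show ?thesis .
  qed
  have "(\<Sum>k\<in>F. (cmod (ell2_inner f (gabor M N g k)))\<^sup>2)
      \<le> (\<Sum>k\<in>A \<times> {..<M}. (cmod (ell2_inner f (gabor M N g k)))\<^sup>2)"
    using A by (intro sum_mono2) auto
  also have "\<dots> = (\<Sum>n\<in>A. \<Sum>m<M. (cmod (ell2_inner f (gabor M N g (n, m))))\<^sup>2)"
    by (simp add: sum.cartesian_product)
  also have "\<dots> \<le> (\<Sum>n\<in>A. \<Sum>m<M. (\<Sum>i\<in>T. (cmod (f (i + n * int N)))\<^sup>2) * G)"
    by (intro sum_mono coeff)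
  also have "\<dots> = real M * G * (\<Sum>n\<in>A. \<Sum>i\<in>T. (cmod (f (i + n * int N)))\<^sup>2)"
    by (simp add: sum_distrib_left sum_distrib_right mult_ac)
  also have "\<dots> = real M * G * (\<Sum>i\<in>T. \<Sum>n\<in>A. (cmod (f (i + n * int N)))\<^sup>2)"
    by (subst sum.swap) simp
  also have "\<dots> \<le> real M * G * (\<Sum>i\<in>T. (ell2_norm f)\<^sup>2)"
    using G0 by (intro mult_left_mono sum_mono shift) auto
  finally show ?thesis by (simp add: G_def mult_ac)
qed

text \<open>Duality: \<open>\<parallel>u\<parallel>\<^sup>2 = \<Sum> c\<^sub>k \<langle>\<phi>\<^sub>k, u\<rangle>\<close> for \<open>u = \<Sum> c\<^sub>k \<phi>\<^sub>k\<close>, then Cauchy-Schwarz.\<close>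

lemma finite_sum_norm_le_of_bessel:
  assumes "finite F" "B \<ge> 0" "\<And>k. k \<in> F \<Longrightarrow> finite (supp (\<phi> k))"
    and bessel: "\<And>f. f \<in> ell2 \<Longrightarrow> (\<Sum>k\<in>F. (cmod (ell2_inner f (\<phi> k)))\<^sup>2) \<le> B * (ell2_norm f)\<^sup>2"
  shows "(ell2_norm (\<lambda>j. \<Sum>k\<in>F. c k * \<phi> k j))\<^sup>2 \<le> B * (\<Sum>k\<in>F. (cmod (c k))\<^sup>2)"
proof -
  define u where "u = (\<lambda>j. \<Sum>k\<in>F. c k * \<phi> k j)"
  define J where "J = (\<Union>k\<in>F. supp (\<phi> k))"
  have J: "finite J" and Jk: "\<And>k. k \<in> F \<Longrightarrow> supp (\<phi> k) \<subseteq> J"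
    using assms(1,3) by (auto simp: J_def)
  have uJ: "supp u \<subseteq> J"
  proof
    fix j assume "j \<in> supp u"
    then have "\<exists>k\<in>F. c k * \<phi> k j \<noteq> 0"
      by (metis (mono_tags, lifting) u_def supp_iff sum.neutral)
    then show "j \<in> J" by (auto simp: J_def supp_def)
  qed
  note u = ell2_finite_support[OF J uJ]
  have "complex_of_real ((ell2_norm u)\<^sup>2) = (\<Sum>j\<in>J. cnj (u j) * u j)"
    unfolding u(2) of_real_sum by (intro sum.cong refl) (simp only: complex_norm_square mult.commute)
  also have "\<dots> = (\<Sum>j\<in>J. \<Sum>k\<in>F. c k * cnj (u j * cnj (\<phi> k j)))"
    by (subst (2) u_def) (simp add: sum_distrib_left mult_ac)
  also have "\<dots> = (\<Sum>k\<in>F. c k * cnj (\<Sum>j\<in>J. u j * cnj (\<phi> k j)))"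
    by (subst sum.swap) (simp add: sum_distrib_left)
  also have "\<dots> = (\<Sum>k\<in>F. c k * cnj (ell2_inner u (\<phi> k)))"
    by (intro sum.cong refl) (simp add: ell2_inner_finite_support[OF J Jk])
  finally have "(ell2_norm u)\<^sup>2 = cmod (\<Sum>k\<in>F. c k * cnj (ell2_inner u (\<phi> k)))"
    by (metis norm_of_real abs_of_nonneg zero_le_power2)
  also have "\<dots> \<le> (\<Sum>k\<in>F. cmod (c k) * cmod (ell2_inner u (\<phi> k)))"
    by (rule order_trans[OF norm_sum]) (simp add: norm_mult)
  finally have "((ell2_norm u)\<^sup>2)\<^sup>2 \<le> (\<Sum>k\<in>F. cmod (c k) * cmod (ell2_inner u (\<phi> k)))\<^sup>2"
    by (intro power_mono) auto
  also have "\<dots> \<le> (\<Sum>k\<in>F. (cmod (c k))\<^sup>2) * (\<Sum>k\<in>F. (cmod (ell2_inner u (\<phi> k)))\<^sup>2)"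
    by (rule Cauchy_Schwarz_ineq_sum)
  also have "\<dots> \<le> (\<Sum>k\<in>F. (cmod (c k))\<^sup>2) * (B * (ell2_norm u)\<^sup>2)"
    by (intro mult_left_mono bessel u sum_nonneg) auto
  finally have *: "(ell2_norm u)\<^sup>2 * (ell2_norm u)\<^sup>2 \<le> (B * (\<Sum>k\<in>F. (cmod (c k))\<^sup>2)) * (ell2_norm u)\<^sup>2"
    by (simp add: power2_eq_square mult_ac)
  show ?thesis
  proof (cases "ell2_norm u = 0")
    case True
    then show ?thesis using assms(2) by (simp add: u_def[symmetric] sum_nonneg)
  next
    case False
    then have "(ell2_norm u)\<^sup>2 > 0" by simp
    from mult_right_le_imp_le[OF * this] show ?thesis by (simp add: u_def)
  qed
qed

text \<open>Finite support makes the Bessel bound automatic, so only the lower inequality carries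
  information. The upper constant is \<open>B + 1\<close> since \<open>B\<close> can be zero, for
  instance when \<open>g\<close> vanishes.\<close>

lemma is_frame_gabor_iff_lower_bound:
  assumes "N \<ge> 1" "finite (supp g)"
  shows "is_frame (gabor_index M) (gabor M N g) \<longleftrightarrow>
    (\<exists>A>0. \<forall>f\<in>ell2. A * (ell2_norm f)\<^sup>2
       \<le> (\<Sum>\<^sub>\<infinity>k\<in>gabor_index M. (cmod (ell2_inner f (gabor M N g k)))\<^sup>2))"
proof -
  define B where "B = real M * real (card (supp g)) * (\<Sum>i\<in>supp g. (cmod (g i))\<^sup>2)"
  have B: "B \<ge> 0" by (simp add: B_def sum_nonneg)
  have bessel: "(\<Sum>k\<in>F. (cmod (ell2_inner f (gabor M N g k)))\<^sup>2) \<le> B * (ell2_norm f)\<^sup>2"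
    if "f \<in> ell2" "finite F" "F \<subseteq> gabor_index M" for f F
    unfolding B_def by (intro gabor_bessel_finite assms order_refl that)
  have summ: "(\<lambda>k. (cmod (ell2_inner f (gabor M N g k)))\<^sup>2) summable_on gabor_index M"
    if "f \<in> ell2" for f
    using bessel[OF that]
    by (intro nonneg_bounded_partial_sums_imp_summable_on[where C = "B * (ell2_norm f)\<^sup>2"])
      (auto intro!: eventually_finite_subsets_at_top_weakI)
  have upper: "(\<Sum>\<^sub>\<infinity>k\<in>gabor_index M. (cmod (ell2_inner f (gabor M N g k)))\<^sup>2)
      \<le> (B + 1) * (ell2_norm f)\<^sup>2" if "f \<in> ell2" for f
  proof -
    have "(\<Sum>\<^sub>\<infinity>k\<in>gabor_index M. (cmod (ell2_inner f (gabor M N g k)))\<^sup>2) \<le> B * (ell2_norm f)\<^sup>2"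
      using bessel[OF that] by (intro infsum_le_finite_sums summ that) auto
    also have "\<dots> \<le> (B + 1) * (ell2_norm f)\<^sup>2" by (intro mult_right_mono) auto
    finally show ?thesis .
  qed
  have "countable (gabor_index M)" by simp
  moreover have "B + 1 > 0" using B by simp
  ultimately show ?thesis
    unfolding is_frame_def using summ upper gabor_in_ell2[OF assms(2)] by blast
qed

text \<open>The upper Riesz bound follows from the Bessel bound by duality, with the same
  \<open>B + 1\<close> to keep the constant positive.\<close>

lemma is_riesz_sequence_gabor_iff_lower_bound:
  assumes "N \<ge> 1" "finite (supp g)"
  shows "is_riesz_sequence (gabor_index M) (gabor M N g) \<longleftrightarrow>
    (\<exists>A>0. \<forall>F c. finite F \<and> F \<subseteq> gabor_index M \<longrightarrow> A * (\<Sum>k\<in>F. (cmod (c k))\<^sup>2)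
       \<le> (ell2_norm (\<lambda>j. \<Sum>k\<in>F. c k * gabor M N g k j))\<^sup>2)"
proof -
  define B where "B = real M * real (card (supp g)) * (\<Sum>i\<in>supp g. (cmod (g i))\<^sup>2)"
  have B: "B \<ge> 0" by (simp add: B_def sum_nonneg)
  have fs: "finite (supp (gabor M N g k))" for k
    using finite_subset[OF supp_gabor[OF order_refl, of M N g]] assms(2) by (cases k) simp
  have upper: "(ell2_norm (\<lambda>j. \<Sum>k\<in>F. c k * gabor M N g k j))\<^sup>2 \<le> (B + 1) * (\<Sum>k\<in>F. (cmod (c k))\<^sup>2)"
    if "finite F" "F \<subseteq> gabor_index M" for F c
  proof -
    have "(ell2_norm (\<lambda>j. \<Sum>k\<in>F. c k * gabor M N g k j))\<^sup>2 \<le> B * (\<Sum>k\<in>F. (cmod (c k))\<^sup>2)"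
    proof (rule finite_sum_norm_le_of_bessel[OF that(1) B fs])
      fix f :: "int \<Rightarrow> complex" assume "f \<in> ell2"
      then show "(\<Sum>k\<in>F. (cmod (ell2_inner f (gabor M N g k)))\<^sup>2) \<le> B * (ell2_norm f)\<^sup>2"
        unfolding B_def using gabor_bessel_finite[OF assms order_refl _ that] by simp
    qed
    also have "\<dots> \<le> (B + 1) * (\<Sum>k\<in>F. (cmod (c k))\<^sup>2)"
      by (intro mult_right_mono sum_nonneg) auto
    finally show ?thesis .
  qed
  have "B + 1 > 0" using B by simp
  show ?thesis (is "_ \<longleftrightarrow> ?lower")
  proof
    assume "is_riesz_sequence (gabor_index M) (gabor M N g)"
    then obtain A B where "A > 0" and AB: "\<forall>F c. finite F \<and> F \<subseteq> gabor_index M \<longrightarrow>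
          A * (\<Sum>k\<in>F. (cmod (c k))\<^sup>2) \<le> (ell2_norm (\<lambda>j. \<Sum>k\<in>F. c k * gabor M N g k j))\<^sup>2 \<and>
          (ell2_norm (\<lambda>j. \<Sum>k\<in>F. c k * gabor M N g k j))\<^sup>2 \<le> B * (\<Sum>k\<in>F. (cmod (c k))\<^sup>2)"
      unfolding is_riesz_sequence_def by (elim conjE exE)
    then show ?lower by (intro exI[of _ A]) simp
  next
    assume ?lower
    then obtain A where A: "A > 0" "\<And>F c. finite F \<Longrightarrow> F \<subseteq> gabor_index M \<Longrightarrow> A * (\<Sum>k\<in>F. (cmod (c k))\<^sup>2)
       \<le> (ell2_norm (\<lambda>j. \<Sum>k\<in>F. c k * gabor M N g k j))\<^sup>2" by auto
    show "is_riesz_sequence (gabor_index M) (gabor M N g)"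
      unfolding is_riesz_sequence_def
    proof (intro conjI)
      show "countable (gabor_index M)" by simp
      show "\<forall>k\<in>gabor_index M. gabor M N g k \<in> ell2" using gabor_in_ell2[OF assms(2)] by simp
    qed (rule exI[of _ A], rule exI[of _ "B + 1"], use A upper \<open>B + 1 > 0\<close> in simp)
  qed
qed

section \<open>Necessity of the support and density conditions\<close>

text \<open>Pigeonhole: fewer than \<open>P\<close> points cannot occupy all \<open>P\<close>
  residue classes.\<close>

lemma missed_residue:
  assumes "finite S" "card S < P"
  obtains r :: int where "\<And>i. i \<in> S \<Longrightarrow> \<not> int P dvd i - r"
proof -
  have "card ((\<lambda>i. i mod int P) ` S) < card {0..<int P}"
    using assms card_image_le[of S "\<lambda>i. i mod int P"] by simp
  then have "\<not> {0..<int P} \<subseteq> (\<lambda>i. i mod int P) ` S"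
    using card_mono[of "(\<lambda>i. i mod int P) ` S" "{0..<int P}"] assms(1) by auto
  then obtain r where r: "r \<in> {0..<int P}" "r \<notin> (\<lambda>i. i mod int P) ` S" by blast
  have "\<not> int P dvd i - r" if "i \<in> S" for i
    using r that by (auto simp: mod_eq_dvd_iff[symmetric] image_iff)
  then show ?thesis using that by blast
qed

text \<open>Shifts by multiples of \<open>N\<close> preserve residue classes modulo
  \<open>N\<close>, so a class missed by \<open>g\<close> is missed by the whole system.\<close>

lemma frame_imp_card_supp_ge:
  assumes "N \<ge> 1" "finite (supp g)" "is_frame (gabor_index M) (gabor M N g)"
  shows "N \<le> card (supp g)"
proof (rule ccontr)
  assume "\<not> ?thesis"
  then obtain r where r: "\<And>i. i \<in> supp g \<Longrightarrow> \<not> int N dvd i - r"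
    using missed_residue[OF assms(2)] by (metis not_le)
  define f :: "int \<Rightarrow> complex" where "f = (\<lambda>j. if j = r then 1 else 0)"
  have sf: "supp f \<subseteq> {r}" by (auto simp: f_def supp_def)
  note f = ell2_finite_support[OF _ sf]
  have "ell2_inner f (gabor M N g (n, m)) = 0" for n m
  proof -
    have "f (i + n * int N) = 0" if "i \<in> supp g" for i
      using r[OF that] by (auto simp: f_def)
    then show ?thesis unfolding ell2_inner_gabor[OF assms(2) order_refl]
      by (intro sum.neutral) auto
  qed
  then have "(\<Sum>\<^sub>\<infinity>k\<in>gabor_index M. (cmod (ell2_inner f (gabor M N g k)))\<^sup>2) = 0"
    by (intro infsum_0) auto
  moreover obtain A where "A > 0" "A * (ell2_norm f)\<^sup>2
       \<le> (\<Sum>\<^sub>\<infinity>k\<in>gabor_index M. (cmod (ell2_inner f (gabor M N g k)))\<^sup>2)"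
    using assms(3) f(1) unfolding is_frame_gabor_iff_lower_bound[OF assms(1,2)] by auto
  ultimately show False using f(2) by (simp add: f_def)
qed

lemma riesz_imp_card_supp_ge:
  assumes "M \<ge> 1" "N \<ge> 1" "finite (supp g)" "is_riesz_sequence (gabor_index M) (gabor M N g)"
  shows "M \<le> card (supp g)"
proof (rule ccontr)
  assume "\<not> ?thesis"
  then obtain r where r: "\<And>i. i \<in> supp g \<Longrightarrow> \<not> int M dvd i - r"
    using missed_residue[OF assms(3)] by (metis not_le)
  \<comment> \<open>Unshifted modulates suffice. Their combination with coefficients
    \<open>c\<close> equals \<open>M\<close> times \<open>g\<close> on the class of \<open>r\<close>
    modulo \<open>M\<close> and zero elsewhere, and \<open>g\<close> vanishes on that class.\<close>
  define F :: "(int \<times> nat) set" where "F = {0} \<times> {..<M}"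
  define c where "c = (\<lambda>k :: int \<times> nat. unit_char M (- r * int (snd k)))"
  have F: "finite F" "F \<subseteq> gabor_index M" by (auto simp: F_def gabor_index_def)
  have "(\<Sum>k\<in>F. c k * gabor M N g k j) = 0" for j
  proof -
    have "(\<Sum>k\<in>F. c k * gabor M N g k j) = (\<Sum>m<M. unit_char M (- r * int m) * (unit_char M (j * int m) * g j))"
      unfolding F_def
      by (rule sum.reindex_bij_witness[of _ "Pair 0" snd]) (auto simp: c_def gabor_apply)
    also have "\<dots> = (\<Sum>m<M. unit_char M ((j - r) * int m)) * g j"
    proof -
      have "unit_char M ((j - r) * int m) = unit_char M (- r * int m) * unit_char M (j * int m)" for m
        unfolding unit_char_add[symmetric] by (simp add: algebra_simps)
      then show ?thesis by (simp add: sum_distrib_right mult.assoc)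
    qed
    also have "\<dots> = 0"
      using r[of j] by (auto simp: sum_unit_char_nat[OF assms(1)] supp_def)
    finally show ?thesis .
  qed
  then have "(ell2_norm (\<lambda>j. \<Sum>k\<in>F. c k * gabor M N g k j))\<^sup>2 = 0"
    by (simp add: ell2_norm_def)
  moreover obtain A where "A > 0" "A * (\<Sum>k\<in>F. (cmod (c k))\<^sup>2)
       \<le> (ell2_norm (\<lambda>j. \<Sum>k\<in>F. c k * gabor M N g k j))\<^sup>2"
    using assms(4) F unfolding is_riesz_sequence_gabor_iff_lower_bound[OF assms(2,3)] by blast
  \<comment> \<open>All coefficients have modulus 1, so their squared sum is \<open>M\<close>, which
    is positive.\<close>
  ultimately show False using assms(1) by (simp add: c_def F_def mult_le_0_iff)
qed

lemma finite_int_bounded: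
  fixes S :: "int set"
  assumes "finite S"
  obtains R :: nat where "S \<subseteq> {- int R..int R}"
proof
  \<comment> \<open>Inserting 0 keeps the maximum meaningful for empty \<open>S\<close> and
    nonnegative, so \<open>nat\<close> loses nothing.\<close>
  show "S \<subseteq> {- int (nat (Max (insert 0 (abs ` S))))..int (nat (Max (insert 0 (abs ` S))))}"
  proof
    fix i assume "i \<in> S"
    then have "\<bar>i\<bar> \<le> Max (insert 0 (abs ` S))" using assms by (intro Max_ge) auto
    then show "i \<in> {- int (nat (Max (insert 0 (abs ` S))))..int (nat (Max (insert 0 (abs ` S))))}"
      by auto
  qed
qed

text \<open>Vectors supported on an interval of L N points have L N degrees of freedom, while only
  about L M members of the system meet that interval. If \<open>N\<close> exceeds \<open>M\<close>
  and \<open>L\<close> is large, some nonzero vector is orthogonal to all of them.\<close>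

lemma frame_imp_density:
  assumes "N \<ge> 1" "finite (supp g)" "is_frame (gabor_index M) (gabor M N g)"
  shows "N \<le> M"
proof (rule ccontr)
  assume "\<not> ?thesis"
  then have NM: "N \<ge> M + 1" by simp
  obtain R where R: "supp g \<subseteq> {- int R..int R}" using finite_int_bounded[OF assms(2)] .
  \<comment> \<open>The count needs (L + 2 R + 1) M < L (M + 1), that is L > (2 R + 1) M; this is
    the least such value.\<close>
  define L where "L = (2 * R + 1) * M + 1"
  define X where "X = {0..<int (L * N)}"
  \<comment> \<open>The shifts that can reach \<open>X\<close>. Since N >= 1, an overhang of
    \<open>R\<close> points is at most \<open>R\<close> shifts on either side.\<close>
  define E where "E = {- int R..int (L + R)} \<times> {..<M}"
  have cE: "card E = (L + 2 * R + 1) * M" and cX: "card X = L * N"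
    using nat_int[of "L + 2 * R + 1"] nat_int[of "L * N"]
    by (simp_all add: E_def X_def card_cartesian_product algebra_simps del: nat_int)
  have "L * N \<ge> L * (M + 1)" using NM by (intro mult_left_mono) auto
  then have "card E < card X"
    unfolding cE cX by (simp add: L_def algebra_simps)
  then obtain c where c: "\<exists>x\<in>X. c x \<noteq> 0"
      "\<forall>k\<in>E. (\<Sum>x\<in>X. cnj (gabor M N g k x) * c x) = 0"
    using homogeneous_system_nontrivial[of E X "\<lambda>k x. cnj (gabor M N g k x)"]
    by (auto simp: E_def X_def)
  define f where "f = (\<lambda>x. if x \<in> X then c x else 0)"
  have X: "finite X" "supp f \<subseteq> X" by (auto simp: X_def f_def supp_def)
  note f = ell2_finite_support[OF X]
  have zero: "ell2_inner f (gabor M N g k) = 0" if "k \<in> gabor_index M" for k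
  proof -
    obtain n m where k: "k = (n, m)" "m < M" using \<open>k \<in> gabor_index M\<close> by (auto simp: gabor_index_def)
    have "ell2_inner f (gabor M N g k) = (\<Sum>x\<in>X. f x * cnj (gabor M N g k x))"
      unfolding ell2_inner_def using X
      by (subst infsum_cong_neutral[of X UNIV _ "\<lambda>x. f x * cnj (gabor M N g k x)"])
        (auto simp: supp_def)
    also have "\<dots> = 0"
    proof (cases "n \<in> {- int R..int (L + R)}")
      case True
      then have "(\<Sum>x\<in>X. cnj (gabor M N g k x) * c x) = 0" using c(2) k by (auto simp: E_def)
      then show ?thesis by (simp add: f_def mult.commute)
    next
      case False
      have "g (x - n * int N) = 0" if "x \<in> X" for x
      proof (rule ccontr)
        assume "g (x - n * int N) \<noteq> 0"
        then have "x - n * int N \<in> {- int R..int R}" using R by (auto simp: supp_def)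
        then have x: "n * int N \<ge> x - int R" "n * int N \<le> x + int R" "0 \<le> x" "x < int L * int N"
          using that by (auto simp: X_def)
        show False
        \<comment> \<open>A shift left of the range moves the support of \<open>g\<close> entirely
          below 0, one right of it entirely beyond L N.\<close>
        proof (cases "n < - int R")
          case True
          then have "(n + int R) * int N \<le> - 1 * int N" by (intro mult_right_mono) auto
          moreover have "int R * int N \<ge> int R * 1" using assms(1) by (intro mult_left_mono) auto
          ultimately show False using x assms(1) by (simp add: algebra_simps)
        next
          case False
          then have "n - int L - int R \<ge> 1" using \<open>n \<notin> _\<close> by auto
          then have "(n - int L - int R) * int N \<ge> 1 * int N" by (intro mult_right_mono) auto
          moreover have "int R * int N \<ge> int R * 1" using assms(1) by (intro mult_left_mono) auto
          ultimately show False using x assms(1) by (simp add: algebra_simps)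
        qed
      qed
      then show ?thesis by (intro sum.neutral) (auto simp: k gabor_apply)
    qed
    finally show ?thesis .
  qed
  have "(\<Sum>\<^sub>\<infinity>k\<in>gabor_index M. (cmod (ell2_inner f (gabor M N g k)))\<^sup>2) = 0"
    using zero by (intro infsum_0) auto
  moreover obtain A where A: "A > 0" "A * (ell2_norm f)\<^sup>2
       \<le> (\<Sum>\<^sub>\<infinity>k\<in>gabor_index M. (cmod (ell2_inner f (gabor M N g k)))\<^sup>2)"
    using assms(3) f(1) unfolding is_frame_gabor_iff_lower_bound[OF assms(1,2)] by auto
  moreover have "(ell2_norm f)\<^sup>2 > 0"
    unfolding f(2) using c(1) X(1) by (auto simp: f_def intro!: sum_pos2)
  ultimately show False by (simp add: mult_le_0_iff)
qed

text \<open>The dual count: L M coefficients produce combinations living on L N + 2 R + 1 points. If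
  \<open>M\<close> exceeds \<open>N\<close> and \<open>L\<close> is large, some nontrivial
  combination vanishes identically.\<close>

lemma riesz_imp_density:
  assumes "N \<ge> 1" "finite (supp g)" "is_riesz_sequence (gabor_index M) (gabor M N g)"
  shows "M \<le> N"
proof (rule ccontr)
  assume "\<not> ?thesis"
  then have NM: "M \<ge> N + 1" by simp
  obtain R where R: "supp g \<subseteq> {- int R..int R}" using finite_int_bounded[OF assms(2)] .
  \<comment> \<open>The count needs L N + 2 R + 1 < L (N + 1), that is L > 2 R + 1.\<close>
  define L where "L = 2 * R + 2"
  define F where "F = {0..<int L} \<times> {..<M}"
  define E where "E = {- int R..int (L * N + R)}"
  have F: "finite F" "F \<subseteq> gabor_index M" by (auto simp: F_def gabor_index_def)
  have cE: "card E = L * N + 2 * R + 1" and cF: "card F = L * M"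
    using nat_int[of "L * N + 2 * R + 1"] nat_int[of L]
    by (simp_all add: E_def F_def card_cartesian_product algebra_simps del: nat_int)
  have "L * M \<ge> L * (N + 1)" using NM by (intro mult_left_mono) auto
  then have "card E < card F"
    unfolding cE cF by (simp add: L_def algebra_simps)
  then obtain c where c: "\<exists>k\<in>F. c k \<noteq> 0"
      "\<forall>j\<in>E. (\<Sum>k\<in>F. gabor M N g k j * c k) = 0"
    using homogeneous_system_nontrivial[of E F "\<lambda>j k. gabor M N g k j"] F
    by (auto simp: E_def)
  \<comment> \<open>On \<open>E\<close> this is the linear system; off \<open>E\<close> every single
    term is zero.\<close>
  have "(\<Sum>k\<in>F. c k * gabor M N g k j) = 0" for j
  proof (cases "j \<in> E")
    case True
    then show ?thesis using c(2) by (simp add: mult.commute)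
  next
    case False
    have "gabor M N g (n, m) j = 0" if "(n, m) \<in> F" for n m
    proof (rule ccontr)
      assume "gabor M N g (n, m) j \<noteq> 0"
      then have "j - n * int N \<in> {- int R..int R}" using R by (auto simp: supp_def gabor_apply)
      moreover have "0 \<le> n * int N" "n * int N \<le> int L * int N"
        using that by (auto simp: F_def intro!: mult_right_mono)
      ultimately show False using False by (auto simp: E_def)
    qed
    then show ?thesis by (intro sum.neutral) auto
  qed
  then have "(ell2_norm (\<lambda>j. \<Sum>k\<in>F. c k * gabor M N g k j))\<^sup>2 = 0"
    by (simp add: ell2_norm_def)
  moreover obtain A where "A > 0" "A * (\<Sum>k\<in>F. (cmod (c k))\<^sup>2)
       \<le> (ell2_norm (\<lambda>j. \<Sum>k\<in>F. c k * gabor M N g k j))\<^sup>2"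
    using assms(3) F unfolding is_riesz_sequence_gabor_iff_lower_bound[OF assms(1,2)] by blast
  moreover have "(\<Sum>k\<in>F. (cmod (c k))\<^sup>2) > 0"
    using c(1) F(1) by (auto intro!: sum_pos2)
  ultimately show False by (simp add: mult_le_0_iff)
qed

section \<open>Sufficiency: plain windows\<close>

definition window :: "int \<Rightarrow> int \<Rightarrow> int \<Rightarrow> complex" where
  "window a b = (\<lambda>j. if a \<le> j \<and> j < b then 1 else 0)"

lemma supp_window: "supp (window a b) = {a..<b}"
  by (auto simp: supp_def window_def)

text \<open>For fixed \<open>n\<close> the coefficients form a discrete Fourier transform of length
  \<open>M\<close> of \<open>f\<close> on one block of \<open>N\<close> points. Since N <= M, these
  points have distinct residues modulo \<open>M\<close>, which gives orthogonality over the
  modulations.\<close>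

lemma gabor_window_parseval:
  assumes "M \<ge> 1" "N \<le> M"
  shows "(\<Sum>m<M. (cmod (ell2_inner f (gabor M N (window 0 (int N)) (n, m))))\<^sup>2)
    = real M * (\<Sum>i\<in>{0..<int N}. (cmod (f (i + n * int N)))\<^sup>2)"
proof -
  have "(\<Sum>m<M. (cmod (ell2_inner f (gabor M N (window 0 (int N)) (n, m))))\<^sup>2)
      = (\<Sum>m<M. (cmod (\<Sum>i\<in>{0..<int N}. f (i + n * int N) * cnj (unit_char M ((i + n * int N) * int m))))\<^sup>2)"
    by (subst ell2_inner_gabor[of "{0..<int N}"]) (auto simp: supp_window, simp add: window_def)
  also have "\<dots> = real M * (\<Sum>i\<in>{0..<int N}. (cmod (f (i + n * int N)))\<^sup>2)"
  proof (rule sum_norm_square_orthogonal)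
    fix a b assume ab: "a \<in> {0..<int N}" "b \<in> {0..<int N}"
    have "(\<Sum>m<M. cnj (unit_char M ((a + n * int N) * int m)) * cnj (cnj (unit_char M ((b + n * int N) * int m))))
        = (\<Sum>m<M. unit_char M ((b - a) * int m))"
      by (simp add: cnj_unit_char unit_char_add[symmetric] algebra_simps)
    also have "\<dots> = (if a = b then of_real (real M) else 0)"
      using dvd_diff_imp_eq[of M b a] ab assms by (auto simp: sum_unit_char_nat)
    finally show "(\<Sum>m<M. cnj (unit_char M ((a + n * int N) * int m)) * cnj (cnj (unit_char M ((b + n * int N) * int m))))
        = (if a = b then of_real (real M) else 0)" .
  qed simp
  finally show ?thesis .
qed

text \<open>Since M <= N, different shifts occupy disjoint blocks. Within one block, the modulates
  are distinct characters on \<open>M\<close> consecutive points and hence orthogonal.\<close>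

lemma gabor_window_norm_sum:
  assumes "M \<ge> 1" "M \<le> N" "finite F" "F \<subseteq> gabor_index M"
  shows "(ell2_norm (\<lambda>j. \<Sum>k\<in>F. c k * gabor M N (window 0 (int M)) k j))\<^sup>2
    = real M * (\<Sum>k\<in>F. (cmod (c k))\<^sup>2)"
proof -
  define \<phi> where "\<phi> = gabor M N (window 0 (int M))"
  define S where "S n = (\<lambda>i. i + n * int N) ` {0..<int M}" for n
  define J where "J = (\<Union>n\<in>fst ` F. S n)"
  have J: "finite J" using assms(3) by (auto simp: J_def S_def)
  have zero: "\<phi> (n, m) j = 0" if "j \<notin> S n" for n m j
    using supp_gabor[of "window 0 (int M)" "{0..<int M}" M N n m] that
    unfolding \<phi>_def S_def by (auto simp: supp_window supp_def[of "gabor _ _ _ _"])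
  have SJ: "S n \<subseteq> J" if "(n, m) \<in> F" for n m using that by (force simp: J_def)
  have disj: "n = n'" if "j \<in> S n" "j \<in> S n'" for n n' j
  proof -
    \<comment> \<open>A block has length M <= N, so division by \<open>N\<close> recovers its
      shift.\<close>
    have "n = j div int N" if j: "j \<in> S n" for n
    proof -
      obtain i where "j = i + n * int N" "0 \<le> i" "i < int N"
        using j assms(2) unfolding S_def by force
      then show ?thesis by simp
    qed
    from this[OF that(1)] this[OF that(2)] show ?thesis by simp
  qed
  have "supp (\<lambda>j. \<Sum>k\<in>F. c k * \<phi> k j) \<subseteq> J"
  proof
    fix j assume "j \<in> supp (\<lambda>j. \<Sum>k\<in>F. c k * \<phi> k j)"
    then obtain k where "k \<in> F" "\<phi> k j \<noteq> 0"
      unfolding supp_iff by (metis (mono_tags, lifting) mult_zero_right sum.neutral)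
    then show "j \<in> J" using zero[of j "fst k" "snd k"] SJ[of "fst k" "snd k"] by auto
  qed
  from ell2_finite_support(2)[OF J this]
  have "(ell2_norm (\<lambda>j. \<Sum>k\<in>F. c k * \<phi> k j))\<^sup>2 = (\<Sum>j\<in>J. (cmod (\<Sum>k\<in>F. c k * \<phi> k j))\<^sup>2)" .
  also have "\<dots> = real M * (\<Sum>k\<in>F. (cmod (c k))\<^sup>2)"
  proof (rule sum_norm_square_orthogonal[OF assms(3)])
    fix k l assume kl: "k \<in> F" "l \<in> F"
    obtain n m n' m' where nm: "k = (n, m)" "l = (n', m')" by (cases k, cases l)
    have mM: "m < M" "m' < M" using kl assms(4) nm by (auto simp: gabor_index_def)
    show "(\<Sum>j\<in>J. \<phi> k j * cnj (\<phi> l j)) = (if k = l then of_real (real M) else 0)"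
    proof (cases "n = n'")
      case False
      then have "\<phi> k j * cnj (\<phi> l j) = 0" for j
        using zero[of j n m] zero[of j n' m'] disj[of j n n'] nm by auto
      then have "(\<Sum>j\<in>J. \<phi> k j * cnj (\<phi> l j)) = 0" by (intro sum.neutral) blast
      then show ?thesis using False nm by simp
    next
      case True
      have "(\<Sum>j\<in>J. \<phi> k j * cnj (\<phi> l j)) = (\<Sum>j\<in>S n. \<phi> k j * cnj (\<phi> l j))"
        using J SJ[of n m] kl nm zero True by (intro sum.mono_neutral_right) auto
      also have "\<dots> = (\<Sum>i\<in>{0..<int M}. \<phi> k (i + n * int N) * cnj (\<phi> l (i + n * int N)))"
        unfolding S_def by (subst sum.reindex) (auto simp: inj_on_def)
      \<comment> \<open>The shift contributes only a phase independent of \<open>i\<close>; what is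
        left is a complete character sum.\<close>
      also have "\<dots> = (\<Sum>i\<in>{0..<int M}. unit_char M (n * int N * (int m - int m')) * unit_char M ((int m - int m') * i))"
        by (intro sum.cong refl)
          (simp add: \<phi>_def nm True gabor_apply window_def cnj_unit_char unit_char_add[symmetric] algebra_simps)
      also have "\<dots> = unit_char M (n * int N * (int m - int m')) * (\<Sum>i\<in>{0..<int M}. unit_char M ((int m - int m') * i))"
        by (simp add: sum_distrib_left)
      also have "(\<Sum>i\<in>{0..<int M}. unit_char M ((int m - int m') * i)) = (\<Sum>i<M. unit_char M ((int m - int m') * int i))"
        by (rule sum.reindex_bij_witness[of _ int nat]) auto
      also have "unit_char M (n * int N * (int m - int m')) * (\<Sum>i<M. unit_char M ((int m - int m') * int i))
          = (if k = l then of_real (real M) else 0)"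
      proof (cases "m = m'")
        case True
        then show ?thesis using \<open>n = n'\<close> nm sum_unit_char_nat[OF assms(1), of 0] by (simp add: unit_char_def)
      next
        case False
        then have "\<not> int M dvd int m - int m'"
          using dvd_diff_imp_eq[of M "int m" "int m'"] mM by linarith
        then show ?thesis using False nm sum_unit_char_nat[OF assms(1)] by simp
      qed
      finally show ?thesis .
    qed
  qed
  finally show ?thesis by (simp add: \<phi>_def)
qed

section \<open>Sufficiency: windows with support of prescribed size\<close>

text \<open>The tail on [P, K) serves only to bring the support up to exactly \<open>K\<close>
  points; its height is chosen to satisfy \<open>window_bessel_bound\<close>.\<close>

definition perturbed_window :: "nat \<Rightarrow> nat \<Rightarrow> int \<Rightarrow> complex" where
  "perturbed_window P K = (\<lambda>j. window 0 (int P) j + of_real (1 / (2 * real K)) * window (int P) (int K) j)"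

lemma supp_perturbed_window:
  assumes "P \<le> K" "K \<ge> 1"
  shows "supp (perturbed_window P K) = {0..<int K}"
  using assms by (auto simp: supp_def perturbed_window_def window_def)

lemma gabor_perturbed_window:
  "gabor M N (perturbed_window P K) k j = gabor M N (window 0 (int P)) k j
     + of_real (1 / (2 * real K)) * gabor M N (window (int P) (int K)) k j"
  by (cases k) (simp add: gabor_apply perturbed_window_def distrib_left)

text \<open>The crude Bessel constant of the tail is M (K - P)^2, at most M K^2, and the squared
  height reduces it to M / 4. This is half of the M / 2 that \<open>norm_add_square_ge\<close>
  retains from the main part, so M / 4 survives as a lower bound.\<close>

lemma window_bessel_bound:
  assumes "P \<le> K" "K \<ge> 1"
  shows "(1 / (2 * real K))\<^sup>2 * (real M * real (card {int P..<int K}) * (\<Sum>i\<in>{int P..<int K}. (cmod (window (int P) (int K) i))\<^sup>2))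
    \<le> real M / 4"
proof -
  have "(\<Sum>i\<in>{int P..<int K}. (cmod (window (int P) (int K) i))\<^sup>2) = (\<Sum>i\<in>{int P..<int K}. 1)"
    by (intro sum.cong) (auto simp: window_def)
  then have e: "(\<Sum>i\<in>{int P..<int K}. (cmod (window (int P) (int K) i))\<^sup>2) = real (K - P)"
    using assms by (simp add: nat_diff_distrib)
  have c: "card {int P..<int K} = K - P" by simp
  have "real (K - P) * real (K - P) \<le> real K * real K" by (intro mult_mono) auto
  then have "real M * (real (K - P) * real (K - P)) \<le> real M * (real K * real K)"
    by (intro mult_left_mono) auto
  then show ?thesis unfolding e c using assms(2) by (simp add: field_simps power2_eq_square)
qed

lemma perturbed_window_frame:
  assumes "M \<ge> 1" "N \<ge> 1" "N \<le> M" "N \<le> K"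
  shows "is_frame (gabor_index M) (gabor M N (perturbed_window N K))"
proof -
  define \<phi> where "\<phi> = gabor M N (perturbed_window N K)"
  define \<phi>0 where "\<phi>0 = gabor M N (window 0 (int N))"
  define \<psi> where "\<psi> = gabor M N (window (int N) (int K))"
  define \<epsilon> where "\<epsilon> = 1 / (2 * real K)"
  define B where "B = real M * real (card {int N..<int K}) * (\<Sum>i\<in>{int N..<int K}. (cmod (window (int N) (int K) i))\<^sup>2)"
  have K: "K \<ge> 1" using assms by simp
  have fin: "finite (supp (perturbed_window N K))" using supp_perturbed_window[OF assms(4) K] by simp
  have B4: "\<epsilon>\<^sup>2 * B \<le> real M / 4" unfolding \<epsilon>_def B_def by (rule window_bessel_bound) (use assms in auto)
  \<comment> \<open>Over the common index set \<open>{0..<int K}\<close> linearity in the window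
    holds termwise; \<epsilon> is real and so unaffected by conjugation.\<close>
  have inner: "ell2_inner f (\<phi> k) = ell2_inner f (\<phi>0 k) + of_real \<epsilon> * ell2_inner f (\<psi> k)" for f k
  proof -
    obtain n m where k: "k = (n, m)" by (cases k)
    have "ell2_inner f (\<phi> k) = (\<Sum>i\<in>{0..<int K}. f (i + n * int N) * cnj (unit_char M ((i + n * int N) * int m) * perturbed_window N K i))"
      unfolding \<phi>_def k using supp_perturbed_window[OF assms(4) K] by (intro ell2_inner_gabor) auto
    moreover have "ell2_inner f (\<phi>0 k) = (\<Sum>i\<in>{0..<int K}. f (i + n * int N) * cnj (unit_char M ((i + n * int N) * int m) * window 0 (int N) i))"
      unfolding \<phi>0_def k using assms by (intro ell2_inner_gabor) (auto simp: supp_window)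
    moreover have "ell2_inner f (\<psi> k) = (\<Sum>i\<in>{0..<int K}. f (i + n * int N) * cnj (unit_char M ((i + n * int N) * int m) * window (int N) (int K) i))"
      unfolding \<psi>_def k using assms by (intro ell2_inner_gabor) (auto simp: supp_window)
    ultimately show ?thesis
      by (simp add: perturbed_window_def \<epsilon>_def sum.distrib[symmetric] sum_distrib_left algebra_simps)
  qed
  have "real M / 4 * (ell2_norm f)\<^sup>2 \<le> (\<Sum>\<^sub>\<infinity>k\<in>gabor_index M. (cmod (ell2_inner f (\<phi> k)))\<^sup>2)"
    (is "_ \<le> ?I") if f: "f \<in> ell2" for f
  proof -
    have summ: "(\<lambda>k. (cmod (ell2_inner f (\<phi> k)))\<^sup>2) summable_on gabor_index M"
      using gabor_bessel_finite[OF assms(2) fin order_refl f, of _ M]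
      unfolding \<phi>_def by (intro nonneg_bounded_partial_sums_imp_summable_on)
      (auto intro!: eventually_finite_subsets_at_top_weakI)
    \<comment> \<open>Working with finite pieces of \<open>f\<close> keeps the block decomposition
      finite. Letting \<open>J\<close> exhaust the integers, half of the squared norm is absorbed on
      the left, which leaves the constant M / 4.\<close>
    have "(\<Sum>j\<in>J. (cmod (f j))\<^sup>2) \<le> 2 / real M * (?I + real M / 4 * (ell2_norm f)\<^sup>2)" if J: "finite J" for J
    proof -
      \<comment> \<open>The blocks of length \<open>N\<close> that meet \<open>J\<close>; their
        union covers \<open>J\<close>, and division with remainder gives unique coordinates on
        it.\<close>
      define A where "A = (\<lambda>j. j div int N) ` J"
      have A: "finite A" using J by (simp add: A_def)
      have sub: "J \<subseteq> (\<lambda>(n, i). i + n * int N) ` (A \<times> {0..<int N})"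
      proof
        fix j assume "j \<in> J"
        then have "(j div int N, j mod int N) \<in> A \<times> {0..<int N}" using assms(2) by (auto simp: A_def)
        then show "j \<in> (\<lambda>(n, i). i + n * int N) ` (A \<times> {0..<int N})"
          by (intro image_eqI[where x = "(j div int N, j mod int N)"]) auto
      qed
      have inj: "inj_on (\<lambda>(n, i). i + n * int N) (A \<times> {0..<int N})"
      proof (rule inj_onI, clarify)
        fix n i n' i' assume *: "i \<in> {0..<int N}" "i' \<in> {0..<int N}" "i + n * int N = i' + n' * int N"
        have "n = (i + n * int N) div int N" using *(1) by auto
        also have "\<dots> = n'" using *(2) by (subst *(3)) auto
        finally show "n = n' \<and> i = i'" using *(3) by simp
      qed
      have "(\<Sum>j\<in>J. (cmod (f j))\<^sup>2) \<le> (\<Sum>j\<in>(\<lambda>(n, i). i + n * int N) ` (A \<times> {0..<int N}). (cmod (f j))\<^sup>2)"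
        using A sub by (intro sum_mono2) auto
      also have "\<dots> = (\<Sum>n\<in>A. \<Sum>i\<in>{0..<int N}. (cmod (f (i + n * int N)))\<^sup>2)"
        by (subst sum.reindex[OF inj]) (simp add: sum.cartesian_product case_prod_unfold)
      finally have "real M * (\<Sum>j\<in>J. (cmod (f j))\<^sup>2) \<le> real M * (\<Sum>n\<in>A. \<Sum>i\<in>{0..<int N}. (cmod (f (i + n * int N)))\<^sup>2)"
        by (intro mult_left_mono) auto
      also have "\<dots> = (\<Sum>n\<in>A. \<Sum>m<M. (cmod (ell2_inner f (\<phi>0 (n, m))))\<^sup>2)"
        unfolding \<phi>0_def gabor_window_parseval[OF assms(1,3)] by (simp add: sum_distrib_left)
      also have "\<dots> = (\<Sum>k\<in>A \<times> {..<M}. (cmod (ell2_inner f (\<phi>0 k)))\<^sup>2)"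
        by (simp add: sum.cartesian_product)
      also have "\<dots> \<le> (\<Sum>k\<in>A \<times> {..<M}. 2 * ((cmod (ell2_inner f (\<phi> k)))\<^sup>2 + \<epsilon>\<^sup>2 * (cmod (ell2_inner f (\<psi> k)))\<^sup>2))"
      proof (rule sum_mono)
        fix k
        show "(cmod (ell2_inner f (\<phi>0 k)))\<^sup>2 \<le> 2 * ((cmod (ell2_inner f (\<phi> k)))\<^sup>2 + \<epsilon>\<^sup>2 * (cmod (ell2_inner f (\<psi> k)))\<^sup>2)"
          using norm_add_square_ge[of "ell2_inner f (\<phi>0 k)" "of_real \<epsilon> * ell2_inner f (\<psi> k)"]
          by (simp add: inner norm_mult power_mult_distrib)
      qed
      also have "\<dots> = 2 * ((\<Sum>k\<in>A \<times> {..<M}. (cmod (ell2_inner f (\<phi> k)))\<^sup>2) + \<epsilon>\<^sup>2 * (\<Sum>k\<in>A \<times> {..<M}. (cmod (ell2_inner f (\<psi> k)))\<^sup>2))"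
        by (simp add: sum_distrib_left sum.distrib)
      also have "\<dots> \<le> 2 * (?I + \<epsilon>\<^sup>2 * (B * (ell2_norm f)\<^sup>2))"
      proof -
        have "(\<Sum>k\<in>A \<times> {..<M}. (cmod (ell2_inner f (\<phi> k)))\<^sup>2) \<le> ?I"
          using A by (intro finite_sum_le_infsum summ) (auto simp: gabor_index_def)
        moreover have "(\<Sum>k\<in>A \<times> {..<M}. (cmod (ell2_inner f (\<psi> k)))\<^sup>2) \<le> B * (ell2_norm f)\<^sup>2"
          unfolding \<psi>_def B_def using A assms(2) f
          by (intro gabor_bessel_finite) (auto simp: gabor_index_def supp_window)
        ultimately show ?thesis by (intro mult_left_mono add_mono) auto
      qed
      also have "\<dots> \<le> 2 * (?I + real M / 4 * (ell2_norm f)\<^sup>2)"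
        using mult_right_mono[OF B4, of "(ell2_norm f)\<^sup>2"] by (simp add: mult.assoc)
      finally show ?thesis using assms(1) by (simp add: field_simps)
    qed
    from ell2_norm_le[OF f this] show ?thesis using assms(1) by (simp add: field_simps)
  qed
  moreover have "real M / 4 > 0" using assms(1) by simp
  ultimately show ?thesis
    unfolding is_frame_gabor_iff_lower_bound[OF assms(2) fin] \<phi>_def by blast
qed

text \<open>The argument parallels the frame case with synthesis in place of analysis: M / 2 comes
  from the orthogonal main part, and the tail costs at most M / 4 by the dual Bessel bound.\<close>

lemma perturbed_window_riesz:
  assumes "M \<ge> 1" "M \<le> N" "M \<le> K"
  shows "is_riesz_sequence (gabor_index M) (gabor M N (perturbed_window M K))"
proof -
  define \<phi> where "\<phi> = gabor M N (perturbed_window M K)"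
  define \<phi>0 where "\<phi>0 = gabor M N (window 0 (int M))"
  define \<psi> where "\<psi> = gabor M N (window (int M) (int K))"
  define \<epsilon> where "\<epsilon> = 1 / (2 * real K)"
  define B where "B = real M * real (card {int M..<int K}) * (\<Sum>i\<in>{int M..<int K}. (cmod (window (int M) (int K) i))\<^sup>2)"
  have K: "K \<ge> 1" and N: "N \<ge> 1" using assms by auto
  have fin: "finite (supp (perturbed_window M K))" using supp_perturbed_window[OF assms(3) K] by simp
  have B0: "B \<ge> 0" by (simp add: B_def sum_nonneg)
  have B4: "\<epsilon>\<^sup>2 * B \<le> real M / 4" unfolding \<epsilon>_def B_def by (rule window_bessel_bound) (use assms in auto)
  have "real M / 4 * (\<Sum>k\<in>F. (cmod (c k))\<^sup>2) \<le> (ell2_norm (\<lambda>j. \<Sum>k\<in>F. c k * \<phi> k j))\<^sup>2"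
    if F: "finite F" "F \<subseteq> gabor_index M" for F c
  proof -
    define u where "u = (\<lambda>j. \<Sum>k\<in>F. c k * \<phi> k j)"
    define u0 where "u0 = (\<lambda>j. \<Sum>k\<in>F. c k * \<phi>0 k j)"
    define v where "v = (\<lambda>j. \<Sum>k\<in>F. c k * \<psi> k j)"
    define C where "C = (\<Sum>k\<in>F. (cmod (c k))\<^sup>2)"
    have C0: "C \<ge> 0" by (simp add: C_def sum_nonneg)
    \<comment> \<open>One finite set contains the supports of all three combinations, so the
      pointwise inequality can be summed over it.\<close>
    define J where "J = (\<Union>k\<in>F. (\<lambda>i. i + fst k * int N) ` {0..<int K})"
    have J: "finite J" using F by (auto simp: J_def)
    have sJ: "supp (\<lambda>j. \<Sum>k\<in>F. c k * gabor M N g k j) \<subseteq> J" if "supp g \<subseteq> {0..<int K}" for g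
    proof
      fix j assume "j \<in> supp (\<lambda>j. \<Sum>k\<in>F. c k * gabor M N g k j)"
      then obtain k where "k \<in> F" "gabor M N g k j \<noteq> 0"
        unfolding supp_iff by (metis (mono_tags, lifting) mult_zero_right sum.neutral)
      then show "j \<in> J" using supp_gabor[OF that, of M N "fst k" "snd k"]
        by (force simp: J_def supp_def)
    qed
    have nu: "(ell2_norm u)\<^sup>2 = (\<Sum>j\<in>J. (cmod (u j))\<^sup>2)"
      unfolding u_def \<phi>_def using supp_perturbed_window[OF assms(3) K]
      by (intro ell2_finite_support(2)[OF J] sJ) auto
    have nu0: "(ell2_norm u0)\<^sup>2 = (\<Sum>j\<in>J. (cmod (u0 j))\<^sup>2)"
      unfolding u0_def \<phi>0_def using assms
      by (intro ell2_finite_support(2)[OF J] sJ) (auto simp: supp_window)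
    have nv: "(ell2_norm v)\<^sup>2 = (\<Sum>j\<in>J. (cmod (v j))\<^sup>2)"
      unfolding v_def \<psi>_def using assms
      by (intro ell2_finite_support(2)[OF J] sJ) (auto simp: supp_window)
    have u: "u j = u0 j + of_real \<epsilon> * v j" for j
      by (simp add: u_def u0_def v_def \<phi>_def \<phi>0_def \<psi>_def \<epsilon>_def gabor_perturbed_window
        sum.distrib sum_distrib_left algebra_simps)
    have "(ell2_norm u0)\<^sup>2 = real M * C"
      unfolding u0_def \<phi>0_def C_def by (rule gabor_window_norm_sum[OF assms(1,2) F])
    moreover have "(ell2_norm v)\<^sup>2 \<le> B * C"
    proof -
      have fs: "finite (supp (\<psi> k))" for k
        using supp_gabor[OF order_refl, of M N "window (int M) (int K)"]
        by (cases k) (auto intro: finite_subset simp: \<psi>_def supp_window)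
      have "(\<Sum>k\<in>F. (cmod (ell2_inner f (\<psi> k)))\<^sup>2) \<le> B * (ell2_norm f)\<^sup>2" if "f \<in> ell2" for f
        unfolding \<psi>_def B_def using N F that
        by (intro gabor_bessel_finite) (auto simp: supp_window)
      then show ?thesis unfolding v_def C_def using F fs B0
        by (intro finite_sum_norm_le_of_bessel) auto
    qed
    then have "\<epsilon>\<^sup>2 * (ell2_norm v)\<^sup>2 \<le> \<epsilon>\<^sup>2 * (B * C)" by (intro mult_left_mono) auto
    moreover have "\<epsilon>\<^sup>2 * (B * C) \<le> real M / 4 * C"
      using mult_right_mono[OF B4 C0] by (simp add: mult.assoc)
    moreover have "(ell2_norm u0)\<^sup>2 / 2 - \<epsilon>\<^sup>2 * (ell2_norm v)\<^sup>2 \<le> (ell2_norm u)\<^sup>2"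
    proof -
      have "(ell2_norm u0)\<^sup>2 / 2 - \<epsilon>\<^sup>2 * (ell2_norm v)\<^sup>2
          = (\<Sum>j\<in>J. (cmod (u0 j))\<^sup>2 / 2 - \<epsilon>\<^sup>2 * (cmod (v j))\<^sup>2)"
        unfolding nu0 nv by (simp add: sum_subtractf sum_divide_distrib sum_distrib_left)
      also have "\<dots> \<le> (\<Sum>j\<in>J. (cmod (u j))\<^sup>2)"
      proof (rule sum_mono)
        fix j
        show "(cmod (u0 j))\<^sup>2 / 2 - \<epsilon>\<^sup>2 * (cmod (v j))\<^sup>2 \<le> (cmod (u j))\<^sup>2"
          using norm_add_square_ge[of "u0 j" "of_real \<epsilon> * v j"]
          by (simp add: u norm_mult power_mult_distrib)
      qed
      finally show ?thesis by (simp add: nu)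
    qed
    ultimately show ?thesis unfolding u_def C_def by simp
  qed
  moreover have "real M / 4 > 0" using assms(1) by simp
  ultimately show ?thesis
    unfolding is_riesz_sequence_gabor_iff_lower_bound[OF N fin] \<phi>_def by blast
qed

theorem theorem2p1:
  fixes M N K :: nat
  assumes "M \<ge> 1" and "N \<ge> 1" and "K \<ge> 1"
  shows "((\<exists>g\<in>ell2. finite (supp g) \<and> card (supp g) = K \<and>
              is_frame (gabor_index M) (gabor M N g))
            \<longleftrightarrow> N \<le> M \<and> K \<ge> N) \<and>
         ((\<exists>g\<in>ell2. finite (supp g) \<and> card (supp g) = K \<and>
              is_riesz_sequence (gabor_index M) (gabor M N g))
            \<longleftrightarrow> N \<ge> M \<and> K \<ge> M)"
proof -
  have g: "perturbed_window P K \<in> ell2" "finite (supp (perturbed_window P K))"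
      "card (supp (perturbed_window P K)) = K" if "P \<le> K" for P
    using supp_perturbed_window[OF that assms(3)] ell2_finite_support(1)[of "{0..<int K}"] by auto
  show ?thesis
  proof (intro conjI iffI)
    assume "\<exists>g\<in>ell2. finite (supp g) \<and> card (supp g) = K \<and> is_frame (gabor_index M) (gabor M N g)"
    then show "N \<le> M" "K \<ge> N"
      using frame_imp_density frame_imp_card_supp_ge assms(2) by blast+
  next
    assume "N \<le> M \<and> K \<ge> N"
    then show "\<exists>g\<in>ell2. finite (supp g) \<and> card (supp g) = K \<and> is_frame (gabor_index M) (gabor M N g)"
      using g[of N] perturbed_window_frame assms by blast
  next
    assume "\<exists>g\<in>ell2. finite (supp g) \<and> card (supp g) = K \<and> is_riesz_sequence (gabor_index M) (gabor M N g)"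
    then show "N \<ge> M" "K \<ge> M"
      using riesz_imp_density riesz_imp_card_supp_ge assms(1,2) by blast+
  next
    assume "N \<ge> M \<and> K \<ge> M"
    then show "\<exists>g\<in>ell2. finite (supp g) \<and> card (supp g) = K \<and> is_riesz_sequence (gabor_index M) (gabor M N g)"
      using g[of M] perturbed_window_riesz assms by blast
  qed
qed

end
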